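(* Let $n\ge 4$ and consider the common edge of two adjacent mesh elements, each parametrised bilinearly. Suppose that the values of all non-middle coefficients, i.e. $L_j,R_j$ for $j\in\{0,1,n-1,n\}$ and $C_j$ for $j\in\{0,1,2,n-2,n-1,n\}$, are given and satisfy the equations Eq(0), Eq(1), Eq(n), Eq(n+1). Then: (1) (Consistency) The "Middle" system $\{\mathrm{Eq}(s):s=2,\dots,n-1\}$ has a solution in terms of the middle coefficients $L_2,\dots,L_{n-2}$, $R_2,\dots,R_{n-2}$, $C_3,\dots,C_{n-3}$. (2) (Classification) The following choice of basic (free) and dependent middle coefficients is valid, in the sense that the basic ones may be given arbitrary values and then the dependent ones are uniquely determined by the Middle system: (a) all "central" middle coefficients $C_3,\dots,C_{n-3}$ (if any) are basic; (b) if the "Projections Relation" $l_0r_1-r_0l_1=0$ does not hold, then among the $2(n-3)$ "side" middle coefficients $L_2,\dots,L_{n-2},R_2,\dots,R_{n-2}$ there are $n-4$ basic and $n-2$ dependent ones; (c) if the "Projections Relation" holds, then among the $2(n-3)$ side middle coefficients there are $n-3$ basic and $n-3$ dependent ones, and in every pair $(L_j,R_j)$, $j=2,\dots,n-2$, one is basic and the other one is dependent.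
   Context: $\langle a,b\rangle=a_Xb_Y-a_Yb_X$ for planar vectors. Two strictly convex planar quadrilaterals (all interior angles less than $\pi$) share exactly the edge from $\gamma$ to $\gamma'$; the right one (relative to the direction $\gamma\to\gamma'$) has vertices $\gamma,\rho,\rho',\gamma'$ and the left one $\gamma,\lambda,\lambda',\gamma'$ (cyclic order). Put $l_0=\langle\rho-\gamma,\gamma'-\gamma\rangle$, $l_1=\langle\gamma-\gamma',\rho'-\gamma'\rangle$, $r_0=-\langle\gamma'-\gamma,\lambda-\gamma\rangle$, $r_1=-\langle\lambda'-\gamma',\gamma-\gamma'\rangle$, $c_0=\langle\rho-\gamma,\lambda-\gamma\rangle$, $c_1=\frac12[\langle\rho-\gamma,\lambda'-\gamma'\rangle-\langle\lambda-\gamma,\rho'-\gamma'\rangle]$, $c_2=-\langle\lambda'-\gamma',\rho'-\gamma'\rangle$. $Z$ is given over each element (in its bilinear parameters) by a tensor-product B\'ezier polynomial of degree $n$; $C_0,\dots,C_n$ are the coefficients along the common edge ordered from $\gamma$ to $\gamma'$, and $L_j$, $R_j$ ($j=0,\dots,n$) those of the neighbouring rows in the left and right element. Set $\Delta L_j=C_j-L_j$, $\Delta R_j=R_j-C_j$ ($0\le j\le n$), $\Delta C_j=C_{j+1}-C_j$ ($0\le j\le n-1$), and all of these equal to $0$ for $j$ outside the indicated ranges. For $s=0,\dots,n+1$, Eq($s$) is $$(n+1-s)(l_0\Delta L_s+r_0\Delta R_s)+s(l_1\Delta L_{s-1}+r_1\Delta R_{s-1})+\tfrac{(n-s)(n+1-s)}{n}c_0\Delta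 C_s+\tfrac{2s(n+1-s)}{n}c_1\Delta C_{s-1}+\tfrac{s(s-1)}{n}c_2\Delta C_{s-2}=0 .$$ (These $n+2$ equations express $G^1$-continuity across the common edge.) Geometrically, the Projections Relation says that the ratio of the distances of $\rho$ and $\rho'$ to the line $\gamma\gamma'$ equals the ratio of the distances of $\lambda$ and $\lambda'$ to that line. *)

theory Defs
  imports "HOL-Analysis.Analysis"
begin

definition cross2 :: "real ^ 2 \<Rightarrow> real ^ 2 \<Rightarrow> real" where
  "cross2 a b = a $ 1 * b $ 2 - a $ 2 * b $ 1"

text \<open>
  A quadrilateral with cyclically ordered vertices \<open>a, b, c, d\<close> has all interior angles in
  \<open>(0, \<pi>)\<close> iff it turns strictly to the same side at every vertex. Four such
  turns add up to exactly \<open>2\<pi>\<close>, so self-intersecting vertex orders are excluded as well.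
\<close>

definition strictly_convex_quad :: "real ^ 2 \<Rightarrow> real ^ 2 \<Rightarrow> real ^ 2 \<Rightarrow> real ^ 2 \<Rightarrow> bool" where
  "strictly_convex_quad a b c d \<longleftrightarrow>
     (cross2 (b - a) (c - b) > 0 \<and> cross2 (c - b) (d - c) > 0 \<and>
      cross2 (d - c) (a - d) > 0 \<and> cross2 (a - d) (b - a) > 0) \<or>
     (cross2 (b - a) (c - b) < 0 \<and> cross2 (c - b) (d - c) < 0 \<and>
      cross2 (d - c) (a - d) < 0 \<and> cross2 (a - d) (b - a) < 0)"

text \<open>
  Vertices of two elements meeting along the edge from \<open>gam\<close> to \<open>gam'\<close>: the right element is
  \<open>gam, rho, rho', gam'\<close> and the left one \<open>gam, lam, lam', gam'\<close>, both in cyclic order.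
\<close>

record edge_config =
  gam :: "real ^ 2"
  gam' :: "real ^ 2"
  rho :: "real ^ 2"
  rho' :: "real ^ 2"
  lam :: "real ^ 2"
  lam' :: "real ^ 2"

text \<open>
  A strictly convex element is the convex hull of its vertices.
\<close>

definition adjacent_elements :: "edge_config \<Rightarrow> bool" where
  "adjacent_elements P \<longleftrightarrow>
     strictly_convex_quad (gam P) (rho P) (rho' P) (gam' P) \<and>
     strictly_convex_quad (gam P) (lam P) (lam' P) (gam' P) \<and>
     convex hull {gam P, rho P, rho' P, gam' P} \<inter> convex hull {gam P, lam P, lam' P, gam' P}
       = closed_segment (gam P) (gam' P) \<and>
     (\<forall>x \<in> {rho P, rho' P}. cross2 (gam' P - gam P) (x - gam P) < 0) \<and>
     (\<forall>x \<in> {lam P, lam' P}. cross2 (gam' P - gam P) (x - gam P) > 0)"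

definition l0 :: "edge_config \<Rightarrow> real" where
  "l0 P = cross2 (rho P - gam P) (gam' P - gam P)"

definition l1 :: "edge_config \<Rightarrow> real" where
  "l1 P = cross2 (gam P - gam' P) (rho' P - gam' P)"

definition r0 :: "edge_config \<Rightarrow> real" where
  "r0 P = - cross2 (gam' P - gam P) (lam P - gam P)"

definition r1 :: "edge_config \<Rightarrow> real" where
  "r1 P = - cross2 (lam' P - gam' P) (gam P - gam' P)"

definition c0 :: "edge_config \<Rightarrow> real" where
  "c0 P = cross2 (rho P - gam P) (lam P - gam P)"

definition c1 :: "edge_config \<Rightarrow> real" where
  "c1 P = 1 / 2 * (cross2 (rho P - gam P) (lam' P - gam' P) - cross2 (lam P - gam P) (rho' P - gam' P))"

definition c2 :: "edge_config \<Rightarrow> real" where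
  "c2 P = - cross2 (lam' P - gam' P) (rho' P - gam' P)"

definition projections_relation :: "edge_config \<Rightarrow> bool" where
  "projections_relation P \<longleftrightarrow> l0 P * r1 P - r0 P * l1 P = 0"

text \<open>
  Names of the Bezier coefficients of \<open>Z\<close> in the three rows along the common edge. Values are
  given by an assignment \<open>z\<close>; only the indices \<open>0, \<dots>, n\<close> are relevant.
\<close>

datatype bez_coef = CL nat | CR nat | CC nat

definition dL :: "nat \<Rightarrow> (bez_coef \<Rightarrow> real) \<Rightarrow> int \<Rightarrow> real" where
  "dL n z j = (if 0 \<le> j \<and> j \<le> int n then z (CC (nat j)) - z (CL (nat j)) else 0)"

definition dR :: "nat \<Rightarrow> (bez_coef \<Rightarrow> real) \<Rightarrow> int \<Rightarrow> real" where
  "dR n z j = (if 0 \<le> j \<and> j \<le> int n then z (CR (nat j)) - z (CC (nat j)) else 0)"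

definition dC :: "nat \<Rightarrow> (bez_coef \<Rightarrow> real) \<Rightarrow> int \<Rightarrow> real" where
  "dC n z j = (if 0 \<le> j \<and> j \<le> int n - 1 then z (CC (nat j + 1)) - z (CC (nat j)) else 0)"

definition G1_eq :: "edge_config \<Rightarrow> nat \<Rightarrow> (bez_coef \<Rightarrow> real) \<Rightarrow> nat \<Rightarrow> bool" where
  "G1_eq P n z s \<longleftrightarrow>
     (real n + 1 - real s) * (l0 P * dL n z (int s) + r0 P * dR n z (int s))
     + real s * (l1 P * dL n z (int s - 1) + r1 P * dR n z (int s - 1))
     + (real n - real s) * (real n + 1 - real s) / real n * c0 P * dC n z (int s)
     + 2 * real s * (real n + 1 - real s) / real n * c1 P * dC n z (int s - 1)
     + real s * (real s - 1) / real n * c2 P * dC n z (int s - 2) = 0"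

definition side_middle :: "nat \<Rightarrow> bez_coef set" where
  "side_middle n = CL ` {2..n - 2} \<union> CR ` {2..n - 2}"

definition central_middle :: "nat \<Rightarrow> bez_coef set" where
  "central_middle n = CC ` {3..n - 3}"

definition middle :: "nat \<Rightarrow> bez_coef set" where
  "middle n = side_middle n \<union> central_middle n"

text \<open>
  These four equations involve non-middle coefficients only, so this is a condition on the values
  of \<open>z\<close> at the non-middle coefficients.
\<close>

definition boundary_eqs :: "edge_config \<Rightarrow> nat \<Rightarrow> (bez_coef \<Rightarrow> real) \<Rightarrow> bool" where
  "boundary_eqs P n z \<longleftrightarrow> (\<forall>s \<in> {0, 1, n, n + 1}. G1_eq P n z s)"

definition middle_system :: "edge_config \<Rightarrow> nat \<Rightarrow> (bez_coef \<Rightarrow> real) \<Rightarrow> bool" where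
  "middle_system P n z \<longleftrightarrow> (\<forall>s \<in> {2..n - 1}. G1_eq P n z s)"

definition splitting :: "nat \<Rightarrow> bez_coef set \<Rightarrow> bez_coef set \<Rightarrow> bool" where
  "splitting n B D \<longleftrightarrow> B \<union> D = middle n \<and> B \<inter> D = {}"

text \<open>
  Basic set \<open>B\<close>, dependent set \<open>D\<close>. The assignment \<open>z\<close> supplies the given non-middle values
  together with arbitrary values of the basic coefficients; its values on \<open>D\<close> are discarded.
\<close>

definition valid_choice :: "edge_config \<Rightarrow> nat \<Rightarrow> bez_coef set \<Rightarrow> bez_coef set \<Rightarrow> bool" where
  "valid_choice P n B D \<longleftrightarrow> splitting n B D \<and>
     (\<forall>z. boundary_eqs P n z \<longrightarrow>
        (\<exists>!z'. (\<forall>x. x \<notin> D \<longrightarrow> z' x = z x) \<and> middle_system P n z'))"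

definition one_of_each_pair :: "nat \<Rightarrow> bez_coef set \<Rightarrow> bez_coef set \<Rightarrow> bool" where
  "one_of_each_pair n B D \<longleftrightarrow>
     (\<forall>j \<in> {2..n - 2}. (CL j \<in> B \<and> CR j \<in> D) \<or> (CL j \<in> D \<and> CR j \<in> B))"

end

theory Submission
  imports Defs
begin

text \<open>
  Write \<open>a\<^sub>j = l\<^sub>0 \<Delta>L\<^sub>j + r\<^sub>0 \<Delta>R\<^sub>j\<close> and
  \<open>b\<^sub>j = l\<^sub>1 \<Delta>L\<^sub>j + r\<^sub>1 \<Delta>R\<^sub>j\<close>. Once all \<open>C\<^sub>j\<close> are fixed, equation \<open>s\<close> reads
  \<open>(n + 1 - s) a\<^sub>s + s b\<^bsub>s-1\<^esub> = const\<close>, so it couples only the side coefficients with indices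
  \<open>s - 1\<close> and \<open>s\<close>. Since the elements lie on opposite sides of the edge, \<open>l\<^sub>0, l\<^sub>1\<close> are positive and
  \<open>r\<^sub>0, r\<^sub>1\<close> are negative; hence, for \<open>s = 2, \<dots>, n - 2\<close> in this order, equation \<open>s\<close> can be solved
  for whichever of \<open>L\<^sub>s\<close>, \<open>R\<^sub>s\<close> is declared dependent (\<open>uniquely_solvable_march\<close>). The whole
  question is what happens to the one remaining equation \<open>n - 1\<close>, in which no new unknown appears.

  If the projections relation fails, \<open>(a\<^sub>j, b\<^sub>j)\<close> is an invertible linear function of
  \<open>(L\<^sub>j, R\<^sub>j)\<close>. Then the march is stopped one step earlier, and equations \<open>n - 2\<close> and \<open>n - 1\<close>
  determine the last pair \<open>(L\<^bsub>n-2\<^esub>, R\<^bsub>n-2\<^esub>)\<close>: this gives \<open>n - 2\<close> dependent coefficients.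

  If the projections relation holds, the equations satisfy a linear relation
  (\<open>G1_residual_syzygy\<close>). The reason is that the left-hand sides are the Bernstein coefficients,
  in degree \<open>n + 1\<close>, of \<open>(n + 1) (l D\<^sub>L + r D\<^sub>R + c D\<^sub>C)\<close>. Here \<open>D\<^sub>L\<close>,
  \<open>D\<^sub>R\<close>, \<open>D\<^sub>C\<close> have the Bernstein coefficients \<open>\<Delta>L\<^sub>j\<close>, \<open>\<Delta>R\<^sub>j\<close>,
  \<open>\<Delta>C\<^sub>j\<close>, the linear polynomials \<open>l\<close>, \<open>r\<close> have \<open>l\<^sub>0, l\<^sub>1\<close> and
  \<open>r\<^sub>0, r\<^sub>1\<close>, and the quadratic \<open>c\<close> has \<open>c\<^sub>0, c\<^sub>1, c\<^sub>2\<close>.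
  The projections relation says that \<open>l\<close> and \<open>r\<close> have the same (projective) root;
  it turns out that \<open>c\<close> vanishes there too (\<open>edge_conic_vanishes\<close>), so the polynomial has
  value \<open>0\<close> at this root. Evaluation there is a linear functional with only nonzero weights,
  so the four boundary equations and the equations \<open>2, \<dots>, n - 2\<close> imply equation \<open>n - 1\<close>, and the
  march alone solves the system. Consistency follows, because one of the two cases always supplies a
  valid choice.
\<close>

section \<open>Geometry of the common edge\<close>

lemma edge_coefficient_signs:
  assumes "adjacent_elements P"
  shows "l0 P > 0" "l1 P > 0" "r0 P < 0" "r1 P < 0"
proof -
  have "cross2 (gam' P - gam P) (rho P - gam P) < 0" "cross2 (gam' P - gam P) (rho' P - gam P) < 0"
    "cross2 (gam' P - gam P) (lam P - gam P) > 0" "cross2 (gam' P - gam P) (lam' P - gam P) > 0"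
    using assms unfolding adjacent_elements_def by blast+
  then show "l0 P > 0" "l1 P > 0" "r0 P < 0" "r1 P < 0"
    unfolding l0_def l1_def r0_def r1_def cross2_def by (simp_all add: algebra_simps)
qed

lemma cross2_eq_0_trans:
  assumes "cross2 p w = 0" "cross2 q w = 0" "w \<noteq> 0"
  shows "cross2 p q = 0"
proof -
  have "w $ 1 * cross2 p q = q $ 1 * cross2 p w - p $ 1 * cross2 q w"
    "w $ 2 * cross2 p q = q $ 2 * cross2 p w - p $ 2 * cross2 q w"
    by (simp_all add: cross2_def algebra_simps)
  then have "w $ 1 * cross2 p q = 0" "w $ 2 * cross2 p q = 0"
    using assms(1,2) by simp_all
  moreover have "w $ 1 \<noteq> 0 \<or> w $ 2 \<noteq> 0"
    using assms(3) by (auto simp: vec_eq_iff forall_2)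
  ultimately show ?thesis by auto
qed

text \<open>
  Up to a factor, the left-hand side is the quadratic \<open>c\<close> evaluated at the root of \<open>l\<close>. There the
  linear interpolant \<open>p\<close> of the transversal vectors \<open>\<rho> - \<gamma>\<close> and \<open>\<rho>' - \<gamma>'\<close> is
  parallel to the edge, and so is, by the projections relation, the interpolant \<open>q\<close> on the left
  side. Since \<open>c = \<langle>p, q\<rangle>\<close> as functions on the edge, \<open>c\<close> vanishes.
\<close>

lemma edge_conic_vanishes:
  assumes "projections_relation P" "l0 P \<noteq> 0"
  shows "c0 P * (l1 P)\<^sup>2 - 2 * c1 P * l0 P * l1 P + c2 P * (l0 P)\<^sup>2 = 0"
proof -
  define w where "w = gam' P - gam P"
  define p where "p = l1 P *\<^sub>R (rho P - gam P) - l0 P *\<^sub>R (rho' P - gam' P)"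
  define q where "q = l1 P *\<^sub>R (lam P - gam P) - l0 P *\<^sub>R (lam' P - gam' P)"
  have w: "w \<noteq> 0"
    using assms(2) by (auto simp: w_def l0_def cross2_def)
  have "cross2 p w = l1 P * cross2 (rho P - gam P) w - l0 P * cross2 (rho' P - gam' P) w"
    by (simp add: p_def cross2_def algebra_simps)
  also have "\<dots> = 0"
    by (simp add: w_def l0_def l1_def cross2_def algebra_simps)
  finally have p: "cross2 p w = 0" .
  have "cross2 q w = l1 P * cross2 (lam P - gam P) w - l0 P * cross2 (lam' P - gam' P) w"
    by (simp add: q_def cross2_def algebra_simps)
  also have "cross2 (lam P - gam P) w = r0 P"
    by (simp add: w_def r0_def cross2_def algebra_simps)
  also have "cross2 (lam' P - gam' P) w = r1 P"
    by (simp add: w_def r1_def cross2_def algebra_simps)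
  finally have q: "cross2 q w = 0"
    using assms(1) by (simp add: projections_relation_def mult.commute)
  have "cross2 p q = c0 P * (l1 P)\<^sup>2 - 2 * c1 P * l0 P * l1 P + c2 P * (l0 P)\<^sup>2"
    by (simp add: p_def q_def c0_def c1_def c2_def cross2_def algebra_simps power2_eq_square)
  with cross2_eq_0_trans[OF p q w] show ?thesis by simp
qed

section \<open>Left-hand sides of the equations\<close>

definition G1_residual :: "edge_config \<Rightarrow> nat \<Rightarrow> (bez_coef \<Rightarrow> real) \<Rightarrow> nat \<Rightarrow> real" where
  "G1_residual P n z s =
     (real n + 1 - real s) * (l0 P * dL n z (int s) + r0 P * dR n z (int s))
     + real s * (l1 P * dL n z (int s - 1) + r1 P * dR n z (int s - 1))
     + (real n - real s) * (real n + 1 - real s) / real n * c0 P * dC n z (int s)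
     + 2 * real s * (real n + 1 - real s) / real n * c1 P * dC n z (int s - 1)
     + real s * (real s - 1) / real n * c2 P * dC n z (int s - 2)"

lemma G1_eq_iff_residual: "G1_eq P n z s \<longleftrightarrow> G1_residual P n z s = 0"
  by (simp add: G1_eq_def G1_residual_def)

lemma G1_eq_cong:
  assumes "\<And>j. z' (CC j) = z (CC j)"
    and "\<And>j. j = s \<or> Suc j = s \<Longrightarrow> j \<le> n \<Longrightarrow> z' (CL j) = z (CL j) \<and> z' (CR j) = z (CR j)"
  shows "G1_eq P n z' s \<longleftrightarrow> G1_eq P n z s"
proof -
  have C: "dC n z' j = dC n z j" for j
    using assms(1) by (simp add: dC_def)
  have L: "dL n z' j = dL n z j \<and> dR n z' j = dR n z j" if "j = int s \<or> j = int s - 1" for j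
  proof (cases "0 \<le> j \<and> j \<le> int n")
    case True
    then have "nat j = s \<or> Suc (nat j) = s" "nat j \<le> n" using that by auto
    with assms(1) assms(2)[of "nat j"] show ?thesis by (simp add: dL_def dR_def)
  next
    case False
    then show ?thesis by (simp only: dL_def dR_def if_False simp_thms)
  qed
  show ?thesis
    using L[of "int s"] L[of "int s - 1"] by (simp add: G1_eq_def C)
qed

lemma boundary_eqs_cong:
  assumes "n \<ge> 4" "\<And>x. x \<notin> side_middle n \<Longrightarrow> z' x = z x"
  shows "boundary_eqs P n z' \<longleftrightarrow> boundary_eqs P n z"
proof -
  have "G1_eq P n z' s \<longleftrightarrow> G1_eq P n z s" if "s \<in> {0, 1, n, n + 1}" for s
  proof (rule G1_eq_cong)
    show "z' (CC j) = z (CC j)" for j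
      by (rule assms(2)) (auto simp: side_middle_def)
    fix j assume "j = s \<or> Suc j = s"
    then have "j \<notin> {2..n - 2}" using that assms(1) by auto
    then show "z' (CL j) = z (CL j) \<and> z' (CR j) = z (CR j)"
      by (intro conjI assms(2)) (auto simp: side_middle_def)
  qed
  then show ?thesis by (auto simp: boundary_eqs_def)
qed

lemma G1_residual_change_pair:
  assumes "j \<le> n" "\<And>x. x \<notin> {CL j, CR j} \<Longrightarrow> z' x = z x"
  shows "G1_residual P n z' j = G1_residual P n z j
           + (real n + 1 - real j) * (r0 P * (z' (CR j) - z (CR j)) - l0 P * (z' (CL j) - z (CL j)))"
    and "G1_residual P n z' (Suc j) = G1_residual P n z (Suc j)
           + real (Suc j) * (r1 P * (z' (CR j) - z (CR j)) - l1 P * (z' (CL j) - z (CL j)))"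
proof -
  have C: "dC n z' i = dC n z i" for i
    using assms(2) by (simp add: dC_def)
  have other: "dL n z' i = dL n z i \<and> dR n z' i = dR n z i" if "i \<noteq> int j" for i
    using assms(2) that by (auto simp: dL_def dR_def)
  have L: "dL n z' (int j) = dL n z (int j) - (z' (CL j) - z (CL j))"
    using assms by (simp add: dL_def)
  have R: "dR n z' (int j) = dR n z (int j) + (z' (CR j) - z (CR j))"
    using assms by (simp add: dR_def)
  have prev: "int (Suc j) - 1 = int j" by simp
  show "G1_residual P n z' j = G1_residual P n z j
      + (real n + 1 - real j) * (r0 P * (z' (CR j) - z (CR j)) - l0 P * (z' (CL j) - z (CL j)))"
    unfolding G1_residual_def C L R using other[of "int j - 1"] by (simp add: algebra_simps)
  show "G1_residual P n z' (Suc j) = G1_residual P n z (Suc j)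
      + real (Suc j) * (r1 P * (z' (CR j) - z (CR j)) - l1 P * (z' (CL j) - z (CL j)))"
    unfolding G1_residual_def C prev L R using other[of "int (Suc j)"]
    by (simp add: algebra_simps)
qed

section \<open>The linear relation between the equations\<close>

text \<open>
  With \<open>t = l\<^sub>0 / l\<^sub>1\<close>, the root \<open>x\<close> of \<open>l\<close> satisfies \<open>x / (1 - x) = - t\<close>, so that the weights
  are those of evaluation at \<open>x\<close>, up to the common factor \<open>(1 - x)\<^sup>n\<^sup>+\<^sup>1\<close>. Leaving this
  factor out covers \<open>l\<^sub>0 = l\<^sub>1\<close> as well, where the root is at infinity.
\<close>

definition edge_root_weight :: "nat \<Rightarrow> real \<Rightarrow> nat \<Rightarrow> real" where
  "edge_root_weight n t s = (- t) ^ s * real ((n + 1) choose s)"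

lemma edge_root_weight_Suc:
  "edge_root_weight n t (Suc j) * real (Suc j) = - t * (real n + 1 - real j) * edge_root_weight n t j"
proof (cases "j \<le> n + 1")
  case True
  have "Suc j * ((n + 1) choose Suc j) = (n + 1 - j) * ((n + 1) choose j)"
    by (simp only: binomial_absorb_comp binomial_absorption)
  then have "real (Suc j) * real ((n + 1) choose Suc j) = real (n + 1 - j) * real ((n + 1) choose j)"
    by (metis of_nat_mult)
  moreover have "real (n + 1 - j) = real n + 1 - real j"
    using True by simp
  moreover have "edge_root_weight n t (Suc j) * real (Suc j)
      = (- t) ^ Suc j * (real (Suc j) * real ((n + 1) choose Suc j))"
    by (simp only: edge_root_weight_def mult_ac)
  ultimately show ?thesis
    by (simp only: edge_root_weight_def power_Suc mult_ac)
next
  case False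
  then show ?thesis by (simp add: edge_root_weight_def binomial_eq_0 del: binomial_Suc_Suc)
qed

text \<open>
  The root of \<open>l\<close> enters only through \<open>l\<^sub>0 - l\<^sub>1 t = 0\<close>, \<open>r\<^sub>0 - r\<^sub>1 t = 0\<close> and
  \<open>c\<^sub>0 - 2 c\<^sub>1 t + c\<^sub>2 t\<^sup>2 = 0\<close>. After collecting the terms with the same \<open>\<Delta>L\<^sub>j\<close>,
  \<open>\<Delta>R\<^sub>j\<close>, \<open>\<Delta>C\<^sub>j\<close>, the recurrence of the weights brings each total coefficient to a
  multiple of one of these three expressions.
\<close>

lemma G1_residual_syzygy:
  assumes "projections_relation P" "l0 P \<noteq> 0" "l1 P \<noteq> 0" "n \<ge> 1"
  shows "(\<Sum>s\<le>n + 1. edge_root_weight n (l0 P / l1 P) s * G1_residual P n z s) = 0"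
proof -
  define t where "t = l0 P / l1 P"
  define w where "w = edge_root_weight n t"
  define a where "a j = l0 P * dL n z j + r0 P * dR n z j" for j
  define b where "b j = l1 P * dL n z j + r1 P * dR n z j" for j
  define g where "g = dC n z"
  define N where "N = real n"
  have N: "N \<noteq> 0" using assms(4) by (simp add: N_def)
  have w_Suc: "w (Suc j) * real (Suc j) = - t * (N + 1 - real j) * w j" for j
    by (simp add: w_def N_def edge_root_weight_Suc del: of_nat_Suc)
  have ab: "a j = t * b j" for j
    using assms(1,3) by (simp add: a_def b_def t_def projections_relation_def field_simps)
  have conic: "c0 P - 2 * c1 P * t + c2 P * t\<^sup>2 = 0"
  proof -
    have "(c0 P - 2 * c1 P * t + c2 P * t\<^sup>2) * (l1 P)\<^sup>2
        = c0 P * (l1 P)\<^sup>2 - 2 * c1 P * l0 P * l1 P + c2 P * (l0 P)\<^sup>2"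
      using assms(3) by (simp add: t_def field_simps power2_eq_square)
    with edge_conic_vanishes[OF assms(1,2)] assms(3) show ?thesis by simp
  qed
  have split: "(\<Sum>s\<le>n + 1. w s * G1_residual P n z s)
      = (\<Sum>s\<le>n + 1. w s * (N + 1 - real s) * a (int s))
      + (\<Sum>s\<le>n + 1. w s * real s * b (int s - 1))
      + (\<Sum>s\<le>n + 1. w s * ((N - real s) * (N + 1 - real s) / N) * c0 P * g (int s))
      + (\<Sum>s\<le>n + 1. w s * (2 * real s * (N + 1 - real s) / N) * c1 P * g (int s - 1))
      + (\<Sum>s\<le>n + 1. w s * (real s * (real s - 1) / N) * c2 P * g (int s - 2))"
    unfolding sum.distrib[symmetric] G1_residual_def a_def b_def g_def N_def
    by (intro sum.cong refl) (simp add: algebra_simps)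
  \<comment> \<open>The polynomial factors in each equation vanish exactly where an index shift would leave the
     range, so no boundary terms arise in the five shifts.\<close>
  have s1: "(\<Sum>s\<le>n + 1. w s * (N + 1 - real s) * a (int s))
      = (\<Sum>j\<le>n. w j * (N + 1 - real j) * a (int j))"
    by (simp add: N_def)
  have s2: "(\<Sum>s\<le>n + 1. w s * real s * b (int s - 1))
      = (\<Sum>j\<le>n. w (Suc j) * real (Suc j) * b (int j))"
    unfolding Suc_eq_plus1[symmetric] sum.atMost_Suc_shift by simp
  have s3: "(\<Sum>s\<le>n + 1. w s * ((N - real s) * (N + 1 - real s) / N) * c0 P * g (int s))
      = (\<Sum>j<n. w j * ((N - real j) * (N + 1 - real j) / N) * c0 P * g (int j))"
    by (simp add: N_def lessThan_Suc_atMost[symmetric])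
  have s4: "(\<Sum>s\<le>n + 1. w s * (2 * real s * (N + 1 - real s) / N) * c1 P * g (int s - 1))
      = (\<Sum>j<n. w (Suc j) * (2 * real (Suc j) * (N - real j) / N) * c1 P * g (int j))"
    unfolding Suc_eq_plus1[symmetric] sum.atMost_Suc_shift
    unfolding lessThan_Suc_atMost[symmetric] by (simp add: N_def)
  have s5: "(\<Sum>s\<le>n + 1. w s * (real s * (real s - 1) / N) * c2 P * g (int s - 2))
      = (\<Sum>j<n. w (Suc (Suc j)) * (real (Suc (Suc j)) * real (Suc j) / N) * c2 P * g (int j))"
    unfolding Suc_eq_plus1[symmetric] sum.atMost_Suc_shift
    unfolding lessThan_Suc_atMost[symmetric] sum.lessThan_Suc_shift by (simp add: algebra_simps)
  have side: "w j * (N + 1 - real j) * a (int j) + w (Suc j) * real (Suc j) * b (int j) = 0" for j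
    unfolding w_Suc ab by simp
  have central: "w j * ((N - real j) * (N + 1 - real j) / N) * c0 P * g (int j)
      + w (Suc j) * (2 * real (Suc j) * (N - real j) / N) * c1 P * g (int j)
      + w (Suc (Suc j)) * (real (Suc (Suc j)) * real (Suc j) / N) * c2 P * g (int j) = 0"
    (is "?S = 0") for j
  proof -
    have w2: "w (Suc (Suc j)) * real (Suc (Suc j)) * real (Suc j)
        = t\<^sup>2 * (N - real j) * (N + 1 - real j) * w j"
    proof -
      have "w (Suc (Suc j)) * real (Suc (Suc j)) * real (Suc j)
          = - t * (N - real j) * (w (Suc j) * real (Suc j))"
        using w_Suc[of "Suc j"] by simp
      also have "\<dots> = t\<^sup>2 * (N - real j) * (N + 1 - real j) * w j"
        unfolding w_Suc by (simp add: power2_eq_square)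
      finally show ?thesis .
    qed
    have "?S = (w j * (N - real j) * (N + 1 - real j) * c0 P
        + 2 * (w (Suc j) * real (Suc j)) * (N - real j) * c1 P
        + (w (Suc (Suc j)) * real (Suc (Suc j)) * real (Suc j)) * c2 P) * g (int j) / N"
      using N by (simp add: field_simps del: of_nat_Suc)
    also have "\<dots> = (w j * (N - real j) * (N + 1 - real j) * (c0 P - 2 * c1 P * t + c2 P * t\<^sup>2))
        * g (int j) / N"
      unfolding w2 unfolding w_Suc by (simp add: algebra_simps)
    finally show ?thesis by (simp add: conic)
  qed
  have "(\<Sum>s\<le>n + 1. w s * G1_residual P n z s) = 0"
  proof -
    have "x + y + p + q + r = 0" if "x + y = 0" "p + q + r = 0" for x y p q r :: real
      using that by linarith
    then show ?thesis
      unfolding split s1 s2 s3 s4 s5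
      by this (simp_all only: sum.distrib[symmetric] side central sum.neutral_const)
  qed
  then show ?thesis by (simp add: w_def t_def)
qed

lemma last_equation_redundant:
  assumes "projections_relation P" "l0 P \<noteq> 0" "l1 P \<noteq> 0" "n \<ge> 4"
    and "boundary_eqs P n z" "\<And>s. s \<in> {2..<n - 1} \<Longrightarrow> G1_eq P n z s"
  shows "G1_eq P n z (n - 1)"
proof -
  have zero: "G1_residual P n z s = 0" if "s \<in> {..n + 1} - {n - 1}" for s
  proof -
    have "s \<in> {0, 1, n, n + 1} \<or> s \<in> {2..<n - 1}" using that assms(4) by auto
    with assms(5,6) show ?thesis by (auto simp: boundary_eqs_def G1_eq_iff_residual)
  qed
  have "0 = (\<Sum>s\<le>n + 1. edge_root_weight n (l0 P / l1 P) s * G1_residual P n z s)"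
    using G1_residual_syzygy[OF assms(1-3)] assms(4) by simp
  also have "\<dots> = edge_root_weight n (l0 P / l1 P) (n - 1) * G1_residual P n z (n - 1)"
    by (subst sum.remove[of _ "n - 1"]) (use zero in auto)
  finally have "edge_root_weight n (l0 P / l1 P) (n - 1) * G1_residual P n z (n - 1) = 0" by simp
  moreover have "edge_root_weight n (l0 P / l1 P) (n - 1) \<noteq> 0"
    using assms(2,3) by (simp add: edge_root_weight_def)
  ultimately show ?thesis by (simp add: G1_eq_iff_residual)
qed

section \<open>Solving block by block\<close>

definition uniquely_solvable :: "'x set \<Rightarrow> (('x \<Rightarrow> real) \<Rightarrow> bool) \<Rightarrow> bool" where
  "uniquely_solvable D S \<longleftrightarrow> (\<forall>z. \<exists>!z'. (\<forall>x. x \<notin> D \<longrightarrow> z' x = z x) \<and> S z')"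

lemma uniquely_solvable_empty: "(\<And>z. S z) \<Longrightarrow> uniquely_solvable {} S"
  by (auto simp: uniquely_solvable_def fun_eq_iff)

text \<open>
  Block forward substitution: the first block is solved without regard to the unknowns \<open>F\<close>,
  on which it does not depend. For uniqueness, resetting any solution on \<open>F\<close> to the given values
  yields the solution of the first block.
\<close>

lemma uniquely_solvable_Un:
  assumes A: "uniquely_solvable D A" and E: "uniquely_solvable F E"
    and indep: "\<And>z z'. (\<And>x. x \<notin> F \<Longrightarrow> z' x = z x) \<Longrightarrow> A z' \<longleftrightarrow> A z"
  shows "uniquely_solvable (D \<union> F) (\<lambda>z. A z \<and> E z)"
  unfolding uniquely_solvable_def
proof
  fix z
  obtain u where u: "\<And>x. x \<notin> D \<Longrightarrow> u x = z x" "A u"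
    and u_unique: "\<And>v. (\<And>x. x \<notin> D \<Longrightarrow> v x = z x) \<Longrightarrow> A v \<Longrightarrow> v = u"
    using A[unfolded uniquely_solvable_def, rule_format, of z] by (auto elim!: ex1E)
  obtain v where v: "\<And>x. x \<notin> F \<Longrightarrow> v x = u x" "E v"
    and v_unique: "\<And>y. (\<And>x. x \<notin> F \<Longrightarrow> y x = u x) \<Longrightarrow> E y \<Longrightarrow> y = v"
    using E[unfolded uniquely_solvable_def, rule_format, of u] by (auto elim!: ex1E)
  show "\<exists>!z'. (\<forall>x. x \<notin> D \<union> F \<longrightarrow> z' x = z x) \<and> A z' \<and> E z'"
  proof (rule ex1I[of _ v])
    show "(\<forall>x. x \<notin> D \<union> F \<longrightarrow> v x = z x) \<and> A v \<and> E v"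
      using u v indep[of v u] by auto
  next
    fix y assume y: "(\<forall>x. x \<notin> D \<union> F \<longrightarrow> y x = z x) \<and> A y \<and> E y"
    define y' where "y' x = (if x \<in> F then z x else y x)" for x
    have "A y'" using y indep[of y' y] by (auto simp: y'_def)
    then have "y' = u" using y by (intro u_unique) (auto simp: y'_def)
    then have "y x = u x" if "x \<notin> F" for x using that by (simp add: y'_def flip: \<open>y' = u\<close>)
    then show "y = v" using y by (intro v_unique) auto
  qed
qed

text \<open>
  The unknown \<open>d\<close> enters equation \<open>j\<close> with coefficient \<open>- (n + 1 - j) l\<^sub>0\<close> or
  \<open>(n + 1 - j) r\<^sub>0\<close>.
\<close>

lemma uniquely_solvable_single:
  assumes "j \<le> n" "l0 P \<noteq> 0" "r0 P \<noteq> 0" "d \<in> {CL j, CR j}"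
  shows "uniquely_solvable {d} (\<lambda>z. G1_eq P n z j)"
  unfolding uniquely_solvable_def
proof
  fix z
  define k where "k = (real n + 1 - real j) * (if d = CL j then - l0 P else r0 P)"
  have k: "k \<noteq> 0" using assms by (auto simp: k_def)
  have res: "G1_residual P n z' j = G1_residual P n z j + k * (z' d - z d)"
    if "\<forall>x. x \<notin> {d} \<longrightarrow> z' x = z x" for z'
    using that assms(4) G1_residual_change_pair(1)[OF assms(1), of z' z P]
    by (auto simp: k_def algebra_simps)
  define y where "y = z (d := z d - G1_residual P n z j / k)"
  show "\<exists>!z'. (\<forall>x. x \<notin> {d} \<longrightarrow> z' x = z x) \<and> G1_eq P n z' j"
  proof (rule ex1I[of _ y])
    show "(\<forall>x. x \<notin> {d} \<longrightarrow> y x = z x) \<and> G1_eq P n y j"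
      using k res[of y] by (simp add: y_def G1_eq_iff_residual)
  next
    fix v assume v: "(\<forall>x. x \<notin> {d} \<longrightarrow> v x = z x) \<and> G1_eq P n v j"
    then have "G1_residual P n z j + k * (v d - z d) = 0"
      using res[of v] by (simp add: G1_eq_iff_residual)
    then have "v d = z d - G1_residual P n z j / k"
      using k by (simp add: field_simps)
    then show "v = y" using v by (auto simp: y_def fun_eq_iff)
  qed
qed

lemma two_by_two_unique:
  fixes a b c d e f :: real
  assumes "a * d - b * c \<noteq> 0"
  obtains x y where "a * x + b * y = e" "c * x + d * y = f"
    "\<And>x' y'. a * x' + b * y' = e \<Longrightarrow> c * x' + d * y' = f \<Longrightarrow> x' = x \<and> y' = y"
proof
  let ?D = "a * d - b * c" and ?x = "(e * d - b * f) / (a * d - b * c)"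
    and ?y = "(a * f - e * c) / (a * d - b * c)"
  have "a * ?x + b * ?y = (a * (e * d - b * f) + b * (a * f - e * c)) / ?D"
    by (simp add: add_divide_distrib)
  also have "\<dots> = e * ?D / ?D" by (simp add: algebra_simps)
  finally show "a * ?x + b * ?y = e" using assms by simp
  have "c * ?x + d * ?y = (c * (e * d - b * f) + d * (a * f - e * c)) / ?D"
    by (simp add: add_divide_distrib)
  also have "\<dots> = f * ?D / ?D" by (simp add: algebra_simps)
  finally show "c * ?x + d * ?y = f" using assms by simp
  fix x' y' assume e: "a * x' + b * y' = e" "c * x' + d * y' = f"
  have "x' * ?D = e * d - b * f" "y' * ?D = a * f - e * c"
    by (simp_all add: e[symmetric] algebra_simps)
  then show "x' = ?x \<and> y' = ?y" using assms by (simp add: eq_divide_eq)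
qed

text \<open>
  Up to nonzero factors, the matrix of equations \<open>j\<close> and \<open>j + 1\<close> in the unknowns \<open>L\<^sub>j\<close>, \<open>R\<^sub>j\<close>
  has rows \<open>(- l\<^sub>0, r\<^sub>0)\<close> and \<open>(- l\<^sub>1, r\<^sub>1)\<close>: its determinant vanishes exactly under the
  projections relation.
\<close>

lemma uniquely_solvable_pair:
  assumes "j \<le> n" "\<not> projections_relation P"
  shows "uniquely_solvable {CL j, CR j} (\<lambda>z. G1_eq P n z j \<and> G1_eq P n z (Suc j))"
  unfolding uniquely_solvable_def
proof
  fix z
  define M where "M = real n + 1 - real j"
  define J where "J = real (Suc j)"
  have MJ: "M \<noteq> 0" "J \<noteq> 0" using assms(1) by (auto simp: M_def J_def)
  let ?E0 = "- G1_residual P n z j / M" and ?E1 = "- G1_residual P n z (Suc j) / J"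
  have iff: "G1_eq P n z' j \<and> G1_eq P n z' (Suc j) \<longleftrightarrow>
      - l0 P * (z' (CL j) - z (CL j)) + r0 P * (z' (CR j) - z (CR j)) = ?E0 \<and>
      - l1 P * (z' (CL j) - z (CL j)) + r1 P * (z' (CR j) - z (CR j)) = ?E1"
    if "\<forall>x. x \<notin> {CL j, CR j} \<longrightarrow> z' x = z x" for z'
  proof -
    have rearr: "r + m * (q - p) = 0 \<longleftrightarrow> - p + q = - r / m" if "m \<noteq> 0" for r m p q :: real
      using that by (auto simp: field_simps)
    have "G1_residual P n z' j = G1_residual P n z j
        + M * (r0 P * (z' (CR j) - z (CR j)) - l0 P * (z' (CL j) - z (CL j)))"
      "G1_residual P n z' (Suc j) = G1_residual P n z (Suc j)
        + J * (r1 P * (z' (CR j) - z (CR j)) - l1 P * (z' (CL j) - z (CL j)))"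
      unfolding M_def J_def using that by (intro G1_residual_change_pair[OF assms(1)]; blast)+
    then show ?thesis
      by (simp only: G1_eq_iff_residual rearr[OF MJ(1)] rearr[OF MJ(2)] mult_minus_left)
  qed
  have "- l0 P * r1 P - r0 P * (- l1 P) \<noteq> 0"
    using assms(2) by (simp add: projections_relation_def)
  then obtain x y where xy: "- l0 P * x + r0 P * y = ?E0" "- l1 P * x + r1 P * y = ?E1"
    and unique: "\<And>x' y'. - l0 P * x' + r0 P * y' = ?E0 \<Longrightarrow> - l1 P * x' + r1 P * y' = ?E1
                   \<Longrightarrow> x' = x \<and> y' = y"
    by (rule two_by_two_unique) blast
  define v where "v = z (CL j := z (CL j) + x, CR j := z (CR j) + y)"
  show "\<exists>!z'. (\<forall>x. x \<notin> {CL j, CR j} \<longrightarrow> z' x = z x) \<and> G1_eq P n z' j \<and> G1_eq P n z' (Suc j)"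
  proof (rule ex1I[of _ v])
    have v: "\<forall>x. x \<notin> {CL j, CR j} \<longrightarrow> v x = z x" by (simp add: v_def)
    moreover have "G1_eq P n v j \<and> G1_eq P n v (Suc j)"
      unfolding iff[OF v] using xy by (simp add: v_def)
    ultimately show
      "(\<forall>x. x \<notin> {CL j, CR j} \<longrightarrow> v x = z x) \<and> G1_eq P n v j \<and> G1_eq P n v (Suc j)" by blast
  next
    fix u assume u: "(\<forall>x. x \<notin> {CL j, CR j} \<longrightarrow> u x = z x) \<and> G1_eq P n u j \<and> G1_eq P n u (Suc j)"
    then have "u (CL j) - z (CL j) = x \<and> u (CR j) - z (CR j) = y"
      using iff[of u] by (intro unique) blast+
    then show "u = v" using u by (auto simp: v_def fun_eq_iff)
  qed
qed

text \<open>
  Which member of each pair is solved for may vary from pair to pair, since each of them occurs in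
  its equation with a nonzero coefficient, and the earlier equations contain neither.
\<close>

lemma uniquely_solvable_march:
  assumes "m \<le> n - 1" "l0 P \<noteq> 0" "r0 P \<noteq> 0" "\<And>j. d j \<in> {CL j, CR j}"
  shows "uniquely_solvable (d ` {2..<m}) (\<lambda>z. \<forall>s\<in>{2..<m}. G1_eq P n z s)"
  using assms(1)
proof (induction m)
  case 0
  then show ?case by (simp add: uniquely_solvable_empty)
next
  case (Suc m)
  show ?case
  proof (cases "m < 2")
    case True
    then have "{2..<Suc m} = {}" by auto
    then show ?thesis by (simp only:) (simp add: uniquely_solvable_empty)
  next
    case False
    have "uniquely_solvable (d ` {2..<m} \<union> {d m})
        (\<lambda>z. (\<forall>s\<in>{2..<m}. G1_eq P n z s) \<and> G1_eq P n z m)"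
    proof (rule uniquely_solvable_Un)
      show "uniquely_solvable (d ` {2..<m}) (\<lambda>z. \<forall>s\<in>{2..<m}. G1_eq P n z s)"
        using Suc by simp
      show "uniquely_solvable {d m} (\<lambda>z. G1_eq P n z m)"
        using Suc.prems assms by (intro uniquely_solvable_single) auto
      fix z z' :: "bez_coef \<Rightarrow> real"
      assume eq: "\<And>x. x \<notin> {d m} \<Longrightarrow> z' x = z x"
      have "G1_eq P n z' s \<longleftrightarrow> G1_eq P n z s" if "s \<in> {2..<m}" for s
        using that assms(4)[of m] by (intro G1_eq_cong) (auto intro!: eq)
      then show "(\<forall>s\<in>{2..<m}. G1_eq P n z' s) \<longleftrightarrow> (\<forall>s\<in>{2..<m}. G1_eq P n z s)" by auto
    qed
    moreover have "{2..<Suc m} = insert m {2..<m}" using False by auto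
    ultimately show ?thesis by (simp add: conj_commute)
  qed
qed

section \<open>Validity of the choices\<close>

lemma valid_choice_without_projections_relation:
  assumes "n \<ge> 4" "l0 P \<noteq> 0" "r0 P \<noteq> 0" "\<not> projections_relation P"
    and split: "splitting n B (CR ` {2..<n - 2} \<union> {CL (n - 2), CR (n - 2)})"
  shows "valid_choice P n B (CR ` {2..<n - 2} \<union> {CL (n - 2), CR (n - 2)})"
proof -
  let ?D = "CR ` {2..<n - 2} \<union> {CL (n - 2), CR (n - 2)}"
  have "uniquely_solvable ?D (\<lambda>z. (\<forall>s\<in>{2..<n - 2}. G1_eq P n z s) \<and>
      G1_eq P n z (n - 2) \<and> G1_eq P n z (Suc (n - 2)))"
  proof (rule uniquely_solvable_Un)
    show "uniquely_solvable (CR ` {2..<n - 2}) (\<lambda>z. \<forall>s\<in>{2..<n - 2}. G1_eq P n z s)"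
      using assms by (intro uniquely_solvable_march) auto
    show "uniquely_solvable {CL (n - 2), CR (n - 2)}
        (\<lambda>z. G1_eq P n z (n - 2) \<and> G1_eq P n z (Suc (n - 2)))"
      using assms by (intro uniquely_solvable_pair) auto
    fix z z' :: "bez_coef \<Rightarrow> real"
    assume eq: "\<And>x. x \<notin> {CL (n - 2), CR (n - 2)} \<Longrightarrow> z' x = z x"
    have "G1_eq P n z' s \<longleftrightarrow> G1_eq P n z s" if "s \<in> {2..<n - 2}" for s
      using that by (intro G1_eq_cong) (auto intro!: eq)
    then show "(\<forall>s\<in>{2..<n - 2}. G1_eq P n z' s) \<longleftrightarrow> (\<forall>s\<in>{2..<n - 2}. G1_eq P n z s)" by auto
  qed
  moreover have "{2..n - 1} = {2..<n - 2} \<union> {n - 2, Suc (n - 2)}"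
    using assms(1) by auto
  then have "middle_system P n = (\<lambda>z. (\<forall>s\<in>{2..<n - 2}. G1_eq P n z s) \<and>
      G1_eq P n z (n - 2) \<and> G1_eq P n z (Suc (n - 2)))"
    unfolding middle_system_def fun_eq_iff by auto
  ultimately show ?thesis
    using split by (simp add: valid_choice_def uniquely_solvable_def)
qed

lemma dependent_set_eq_image:
  assumes "splitting n B D" "central_middle n \<subseteq> B" "one_of_each_pair n B D"
  shows "D = (\<lambda>j. if CL j \<in> D then CL j else CR j) ` {2..n - 2}" (is "D = ?d ` _")
proof
  have disj: "B \<inter> D = {}" using assms(1) by (simp add: splitting_def)
  show "D \<subseteq> ?d ` {2..n - 2}"
  proof
    fix x assume x: "x \<in> D"
    then have "x \<in> side_middle n"
      using assms(1,2) by (auto simp: splitting_def middle_def)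
    then obtain j where j: "j \<in> {2..n - 2}" "x = CL j \<or> x = CR j"
      by (auto simp: side_middle_def)
    then have "x = ?d j"
      using x assms(3) disj by (auto simp: one_of_each_pair_def)
    with j(1) show "x \<in> ?d ` {2..n - 2}" by blast
  qed
  show "?d ` {2..n - 2} \<subseteq> D"
    using assms(3) by (auto simp: one_of_each_pair_def)
qed

lemma valid_choice_with_projections_relation:
  assumes "n \<ge> 4" "l0 P \<noteq> 0" "l1 P \<noteq> 0" "r0 P \<noteq> 0" "projections_relation P"
    and split: "splitting n B D" "central_middle n \<subseteq> B" "one_of_each_pair n B D"
  shows "valid_choice P n B D"
proof -
  define d where "d = (\<lambda>j. if CL j \<in> D then CL j else CR j)"
  have "D = d ` {2..n - 2}"
    unfolding d_def by (rule dependent_set_eq_image[OF split])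
  moreover have "{2..n - 2} = {2..<n - 1}" using assms(1) by auto
  ultimately have D: "D = d ` {2..<n - 1}" by (simp only:)
  have "uniquely_solvable (d ` {2..<n - 1}) (\<lambda>z. \<forall>s\<in>{2..<n - 1}. G1_eq P n z s)"
    using assms by (intro uniquely_solvable_march) (auto simp: d_def)
  then have solv: "uniquely_solvable D (\<lambda>z. \<forall>s\<in>{2..<n - 1}. G1_eq P n z s)"
    by (simp only: D[symmetric])
  have D_side: "D \<subseteq> side_middle n"
    using split(1,2) by (auto simp: splitting_def middle_def)
  have "\<exists>!z'. (\<forall>x. x \<notin> D \<longrightarrow> z' x = z x) \<and> middle_system P n z'" if bd: "boundary_eqs P n z" for z
  proof -
    have "middle_system P n z' \<longleftrightarrow> (\<forall>s\<in>{2..<n - 1}. G1_eq P n z' s)"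
      if eq: "\<forall>x. x \<notin> D \<longrightarrow> z' x = z x" for z'
    proof -
      have "boundary_eqs P n z'"
        using boundary_eqs_cong[OF assms(1), of z' z P] eq D_side bd by auto
      moreover have "{2..n - 1} = insert (n - 1) {2..<n - 1}" using assms(1) by auto
      ultimately show ?thesis
        using last_equation_redundant[OF assms(5,2,3,1), of z'] by (auto simp: middle_system_def)
    qed
    then have "((\<forall>x. x \<notin> D \<longrightarrow> z' x = z x) \<and> middle_system P n z') \<longleftrightarrow>
        (\<forall>x. x \<notin> D \<longrightarrow> z' x = z x) \<and> (\<forall>s\<in>{2..<n - 1}. G1_eq P n z' s)" for z'
      by blast
    then show ?thesis
      using solv[unfolded uniquely_solvable_def, rule_format, of z] by (simp only:)
  qed
  with split(1) show ?thesis by (simp add: valid_choice_def)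
qed

lemma ex_valid_choice_without_projections_relation:
  assumes "n \<ge> 4" "l0 P \<noteq> 0" "r0 P \<noteq> 0" "\<not> projections_relation P"
  shows "\<exists>B D. valid_choice P n B D \<and> central_middle n \<subseteq> B \<and>
           card (B \<inter> side_middle n) = n - 4 \<and> card (D \<inter> side_middle n) = n - 2"
proof (intro exI conjI)
  let ?B = "CL ` {2..<n - 2} \<union> central_middle n"
    and ?D = "CR ` {2..<n - 2} \<union> {CL (n - 2), CR (n - 2)}"
  have upto: "{2..n - 2} = insert (n - 2) {2..<n - 2}" using assms(1) by auto
  have "splitting n ?B ?D"
    unfolding splitting_def middle_def side_middle_def central_middle_def upto by auto
  then show "valid_choice P n ?B ?D"
    by (rule valid_choice_without_projections_relation[OF assms])
  show "central_middle n \<subseteq> ?B" by simp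
  have "?B \<inter> side_middle n = CL ` {2..<n - 2}"
    unfolding side_middle_def central_middle_def upto by auto
  then show "card (?B \<inter> side_middle n) = n - 4"
    by (simp add: card_image inj_on_def)
  have "?D \<inter> side_middle n = insert (CL (n - 2)) (CR ` {2..n - 2})"
    unfolding side_middle_def upto by auto
  moreover have "CL (n - 2) \<notin> CR ` {2..n - 2}" by blast
  ultimately have "card (?D \<inter> side_middle n) = Suc (card (CR ` {2..n - 2}))"
    by (simp only: card_insert_disjoint finite_imageI finite_atLeastAtMost not_False_eq_True)
  then show "card (?D \<inter> side_middle n) = n - 2"
    using assms(1) by (simp add: card_image inj_on_def)
qed

lemma ex_valid_choice_with_projections_relation:
  assumes "n \<ge> 4" "l0 P \<noteq> 0" "l1 P \<noteq> 0" "r0 P \<noteq> 0" "projections_relation P"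
  shows "\<exists>B D. valid_choice P n B D \<and> central_middle n \<subseteq> B \<and>
           card (B \<inter> side_middle n) = n - 3 \<and> card (D \<inter> side_middle n) = n - 3 \<and>
           one_of_each_pair n B D"
proof (intro exI conjI)
  let ?B = "CL ` {2..n - 2} \<union> central_middle n" and ?D = "CR ` {2..n - 2}"
  have "splitting n ?B ?D"
    by (auto simp: splitting_def middle_def side_middle_def central_middle_def)
  moreover show central: "central_middle n \<subseteq> ?B" by simp
  moreover show pairs: "one_of_each_pair n ?B ?D" by (simp add: one_of_each_pair_def)
  ultimately show "valid_choice P n ?B ?D"
    by (rule valid_choice_with_projections_relation[OF assms])
  have "?B \<inter> side_middle n = CL ` {2..n - 2}"
    by (auto simp: side_middle_def central_middle_def)
  then show "card (?B \<inter> side_middle n) = n - 3"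
    by (simp add: card_image inj_on_def)
  have "?D \<inter> side_middle n = CR ` {2..n - 2}"
    by (auto simp: side_middle_def)
  then show "card (?D \<inter> side_middle n) = n - 3"
    by (simp add: card_image inj_on_def)
qed

lemma middle_system_consistent:
  assumes "valid_choice P n B D" "boundary_eqs P n z"
  shows "\<exists>z'. (\<forall>x. x \<notin> middle n \<longrightarrow> z' x = z x) \<and> middle_system P n z'"
proof -
  have "D \<subseteq> middle n" using assms(1) by (auto simp: valid_choice_def splitting_def)
  moreover have "\<exists>!z'. (\<forall>x. x \<notin> D \<longrightarrow> z' x = z x) \<and> middle_system P n z'"
    using assms by (simp add: valid_choice_def)
  then obtain z' where "\<forall>x. x \<notin> D \<longrightarrow> z' x = z x" "middle_system P n z'"
    by (elim ex1E conjE)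
  ultimately show ?thesis by blast
qed

theorem theorem5:
  fixes P :: edge_config and n :: nat
  assumes "n \<ge> 4"
    and "adjacent_elements P"
  shows "(\<forall>z. boundary_eqs P n z \<longrightarrow>
            (\<exists>z'. (\<forall>x. x \<notin> middle n \<longrightarrow> z' x = z x) \<and> middle_system P n z')) \<and>
         (\<not> projections_relation P \<longrightarrow>
            (\<exists>B D. valid_choice P n B D \<and> central_middle n \<subseteq> B \<and>
               card (B \<inter> side_middle n) = n - 4 \<and> card (D \<inter> side_middle n) = n - 2)) \<and>
         (projections_relation P \<longrightarrow>
            (\<exists>B D. valid_choice P n B D \<and> central_middle n \<subseteq> B \<and>
               card (B \<inter> side_middle n) = n - 3 \<and> card (D \<inter> side_middle n) = n - 3 \<and>
               one_of_each_pair n B D) \<and>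
            (\<forall>B D. splitting n B D \<and> central_middle n \<subseteq> B \<and> one_of_each_pair n B D \<longrightarrow>
               valid_choice P n B D))"
proof -
  have nz: "l0 P \<noteq> 0" "l1 P \<noteq> 0" "r0 P \<noteq> 0"
    using edge_coefficient_signs[OF assms(2)] by simp_all
  note general = ex_valid_choice_without_projections_relation[OF assms(1) nz(1,3)]
    and special = ex_valid_choice_with_projections_relation[OF assms(1) nz]
    and all_pairs = valid_choice_with_projections_relation[OF assms(1) nz]
  have "\<exists>B D. valid_choice P n B D"
  proof (cases "projections_relation P")
    case True
    from special[OF this] show ?thesis by blast
  next
    case False
    from general[OF this] show ?thesis by blast
  qed
  then obtain B D where BD: "valid_choice P n B D" by blast
  show ?thesis
  proof (intro conjI)
    show "\<forall>z. boundary_eqs P n z \<longrightarrow>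
        (\<exists>z'. (\<forall>x. x \<notin> middle n \<longrightarrow> z' x = z x) \<and> middle_system P n z')"
      using middle_system_consistent[OF BD] by (intro allI impI)
  next
    show "\<not> projections_relation P \<longrightarrow>
        (\<exists>B D. valid_choice P n B D \<and> central_middle n \<subseteq> B \<and>
           card (B \<inter> side_middle n) = n - 4 \<and> card (D \<inter> side_middle n) = n - 2)"
      using general by (intro impI)
  next
    show "projections_relation P \<longrightarrow>
        (\<exists>B D. valid_choice P n B D \<and> central_middle n \<subseteq> B \<and>
           card (B \<inter> side_middle n) = n - 3 \<and> card (D \<inter> side_middle n) = n - 3 \<and>
           one_of_each_pair n B D) \<and>
        (\<forall>B D. splitting n B D \<and> central_middle n \<subseteq> B \<and> one_of_each_pair n B D \<longrightarrow>
           valid_choice P n B D)"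
    proof (intro impI conjI allI)
      assume pr: "projections_relation P"
      from special[OF this] show "\<exists>B D. valid_choice P n B D \<and> central_middle n \<subseteq> B \<and>
           card (B \<inter> side_middle n) = n - 3 \<and> card (D \<inter> side_middle n) = n - 3 \<and>
           one_of_each_pair n B D" .
      fix B D
      assume "splitting n B D \<and> central_middle n \<subseteq> B \<and> one_of_each_pair n B D"
      then show "valid_choice P n B D"
        using all_pairs[OF pr] by simp
    qed
  qed
qed

end
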